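(* Let $S_1,\dots,S_n$ be finite subsets of $R$ and let $(B_a\mid a\in\prod_{i=1}^nS_i)$ be subsets of $\mathbb{N}^n$ such that $\mathbb{N}^n\setminus\nabla(B_a)$ is finite for every $a$. Put $\zeta_1=\sum_{a\in\prod_i S_i}|\mathbb{N}^n\setminus\nabla(B_a)|$ and $$Q=\{f\in\Omega:\ \mathrm{supp}(f(x_1+a_1,\dots,x_n+a_n))\subseteq\nabla(B_a)\text{ for all }a\in\textstyle\prod_{i=1}^nS_i\},$$ an ideal of $\Omega$. Let $\Lambda$ be a finite set, $(g(\lambda)\mid\lambda\in\Lambda)\in Q^{\Lambda}$ a family of monic polynomials, $\theta(\lambda)$ the greatest element of $\mathrm{supp}(g(\lambda))$, $D=\{\theta(\lambda)\mid\lambda\in\Lambda\}$, and assume $\mathbb{N}^n\setminus\nabla(D)$ is finite; put $\zeta_2=|\mathbb{N}^n\setminus\nabla(D)|$. Then: (1) If every $S_i$ satisfies Condition (D) in $R$, then $\zeta_1\leqslant\zeta_2$, and $(g(\lambda)\mid\lambda\in\Lambda)$ is a Gröbner basis of $Q$ if and only if $\zeta_1=\zeta_2$. (2) If $\prod_{i=1}^nS_i\neq\emptyset$, $\mathbf{0}\notin B_a$ for all $a\in\prod_iS_i$, $\zeta_1\leqslant\zeta_2$, and $(g(\lambda)\mid\lambda\in\Lambda)$ is a Gröbner basis of $Q$, then $\zeta_1=\zeta_2$ and every $S_k$ ($k\in\{1,\dots,n\}$) satisfies Condition (D) in $R$.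
   Context: Let $R$ be a commutative ring with identity $1_R$, $n$ a positive integer, $\mathbb{N}=\{0,1,2,\dots\}$, $\Omega=R[x_1,\dots,x_n]$, $\mathbf{0}$ the zero vector of $\mathbb{N}^n$. For $\alpha,\beta\in\mathbb{N}^n$, $\alpha\leqslant\beta$ means $\alpha_i\leqslant\beta_i$ for all $i$. For $f\in\Omega$, $f_{[\alpha]}$ is the coefficient of $x_1^{\alpha_1}\cdots x_n^{\alpha_n}$ and $\mathrm{supp}(f)=\{\alpha: f_{[\alpha]}\neq0\}$. For $A\subseteq\mathbb{N}^n$, $\nabla(A)=\{\beta:\exists\alpha\in A,\ \alpha\leqslant\beta\}$. A polynomial $g$ is monic if $\mathrm{supp}(g)$ has a greatest element $\theta$ for $\leqslant$ and $g_{[\theta]}=1_R$. A family $(g(\lambda))_{\lambda\in\Lambda}$ (finite $\Lambda$) of monic polynomials with greatest support elements $\theta(\lambda)$, all lying in an ideal $Q$, is a Gröbner basis of $Q$ if for every $\tau\in Q\setminus\{0\}$ there exist $\alpha\in\mathrm{supp}(\tau)$ and $r\in\Lambda$ with $\theta(r)\leqslant\alpha$. A subset $X\subseteq R$ satisfies Condition (D) in $R$ if for all $a\neq b$ in $X$, $b-a$ is not a zero divisor of $R$ (i.e., there is no $w\neq0$ with $(b-a)w=0$). *)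

theory Defs
  imports Complex_Main "HOL-Library.Poly_Mapping" "HOL-Library.Function_Algebras" "HOL-Library.FuncSet"
begin

text \<open>
  \<open>R[x\<^sub>1, \<dots>, x\<^sub>n]\<close> is the monoid algebra of the exponent monoid \<open>\<nat>\<^sup>n\<close> over \<open>R\<close>. The variables are
  indexed by a finite type \<open>'n\<close> (every finite nonempty index set arises this way). Exponents are
  plain functions \<open>'n \<Rightarrow> nat\<close> rather than \<open>'n \<Rightarrow>\<^sub>0 nat\<close>, because \<open>\<le>\<close> on functions is the
  componentwise order, whereas \<open>\<le>\<close> on \<open>\<Rightarrow>\<^sub>0\<close> is lexicographic. Coefficients are given by
  \<open>lookup\<close> and the support by \<open>keys\<close>.
\<close>

type_synonym ('n, 'r) mpol = "('n \<Rightarrow> nat) \<Rightarrow>\<^sub>0 'r"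

definition mConst :: "'r \<Rightarrow> ('n, 'r::comm_ring_1) mpol" where
  "mConst c = Poly_Mapping.single 0 c"

definition mVar :: "'n \<Rightarrow> ('n, 'r::comm_ring_1) mpol" where
  "mVar i = Poly_Mapping.single (\<lambda>j. if j = i then 1 else 0) 1"

definition mSubst :: "('n::finite, 'r::comm_ring_1) mpol \<Rightarrow> ('n \<Rightarrow> ('n, 'r) mpol) \<Rightarrow> ('n, 'r) mpol" where
  "mSubst f p = (\<Sum>\<alpha>\<in>Poly_Mapping.keys f. mConst (Poly_Mapping.lookup f \<alpha>) * (\<Prod>i\<in>UNIV. p i ^ \<alpha> i))"

definition shift :: "('n::finite, 'r::comm_ring_1) mpol \<Rightarrow> ('n \<Rightarrow> 'r) \<Rightarrow> ('n, 'r) mpol" where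
  "shift f a = mSubst f (\<lambda>i. mVar i + mConst (a i))"

definition nabla :: "('n \<Rightarrow> nat) set \<Rightarrow> ('n \<Rightarrow> nat) set" where
  "nabla A = {\<beta>. \<exists>\<alpha>\<in>A. \<alpha> \<le> \<beta>}"

definition monic :: "('n, 'r::comm_ring_1) mpol \<Rightarrow> bool" where
  "monic g \<longleftrightarrow> (\<exists>\<theta>\<in>Poly_Mapping.keys g.
      (\<forall>\<alpha>\<in>Poly_Mapping.keys g. \<alpha> \<le> \<theta>) \<and> Poly_Mapping.lookup g \<theta> = 1)"

text \<open>The greatest element of the support; unspecified if there is none.\<close>

definition lead_exp :: "('n, 'r::comm_ring_1) mpol \<Rightarrow> ('n \<Rightarrow> nat)" where
  "lead_exp g = (GREATEST \<alpha>. \<alpha> \<in> Poly_Mapping.keys g)"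

text \<open>An ideal is a submodule of the ring regarded as a module over itself.\<close>

abbreviation is_ideal :: "'a::comm_ring_1 set \<Rightarrow> bool" where
  "is_ideal \<equiv> module.subspace (*)"

definition groebner_basis ::
    "('n, 'r::comm_ring_1) mpol set \<Rightarrow> 'l set \<Rightarrow> ('l \<Rightarrow> ('n, 'r) mpol) \<Rightarrow> bool" where
  "groebner_basis Q \<Lambda> g \<longleftrightarrow>
     is_ideal Q \<and> finite \<Lambda> \<and> (\<forall>l\<in>\<Lambda>. monic (g l) \<and> g l \<in> Q) \<and>
     (\<forall>\<tau>\<in>Q - {0}. \<exists>\<alpha>\<in>Poly_Mapping.keys \<tau>. \<exists>r\<in>\<Lambda>. lead_exp (g r) \<le> \<alpha>)"

text \<open>Note that \<open>0\<close> counts as a zero divisor.\<close>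

definition zero_divisor :: "'r::comm_ring_1 \<Rightarrow> bool" where
  "zero_divisor c \<longleftrightarrow> (\<exists>w. w \<noteq> 0 \<and> c * w = 0)"

definition condition_D :: "'r::comm_ring_1 set \<Rightarrow> bool" where
  "condition_D X \<longleftrightarrow> (\<forall>a\<in>X. \<forall>b\<in>X. a \<noteq> b \<longrightarrow> \<not> zero_divisor (b - a))"

text \<open>As \<open>S\<close> is indexed by all of \<open>'n\<close>, the product of the \<open>S i\<close> is \<open>Pi UNIV S\<close>.\<close>

definition Q_ideal ::
    "('n::finite \<Rightarrow> 'r::comm_ring_1 set) \<Rightarrow> (('n \<Rightarrow> 'r) \<Rightarrow> ('n \<Rightarrow> nat) set) \<Rightarrow> ('n, 'r) mpol set" where
  "Q_ideal S B = {f. \<forall>a\<in>Pi UNIV S. Poly_Mapping.keys (shift f a) \<subseteq> nabla (B a)}"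

end

(* Let I be the set of pairs (a, gamma) with a in the product of the S i and gamma outside nabla (B a),
   and J the complement of nabla D, so that |I| = zeta1 and |J| = zeta2. Sending f to the coefficients of
   its Taylor expansions indexed by I is a linear map with kernel Q; let A be the matrix, with rows I and
   columns J, of its restriction to polynomials supported in J. The family is a Groebner basis iff A has
   trivial kernel.

   By McCoy's theorem, a matrix over a commutative ring with trivial kernel has, for every w <> 0, a minor
   of full column size not killed by w; hence it has at least as many rows as columns, and if it is square
   its transpose also has trivial kernel. Division by the monic g l shows that a linear relation between
   the rows of A is one between the Taylor functionals on all polynomials, and under Condition (D) these
   are independent, so A transposed has trivial kernel: this gives (1). For (2), A is square; if
   w * (c - b) = 0 with b, c in S k and w <> 0, then w times the evaluations at two points that differ
   only in the coordinate k, with values b and c, coincide, so the transpose has a nonzero kernel vector. *)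

theory Submission
  imports "Jordan_Normal_Form.Determinant" Defs
begin

section \<open>McCoy's theorem on linear systems\<close>

text \<open>Induction on the size: a minor of size \<open>r\<close> not killed by \<open>w\<close>
  is bordered by a fresh column \<open>j0\<close> and a suitable row. For \<open>r = 0\<close> the
  determinant is 1. Injectivity of \<open>f\<close> is left to
  \<open>inj_on_rows_of_minor\<close>.\<close>

lemma nonzero_minor_of_injective_system:
  fixes A :: "'i \<Rightarrow> 'j \<Rightarrow> 'r::comm_ring_1"
  assumes "finite J"
    and inj: "\<And>v. (\<And>i. i \<in> I \<Longrightarrow> (\<Sum>j\<in>J. A i j * v j) = 0) \<Longrightarrow> \<forall>j\<in>J. v j = 0"
    and w: "w \<noteq> 0"
    and "r \<le> card J"
  shows "\<exists>f h. inj_on h {..<r} \<and> h ` {..<r} \<subseteq> J \<and> f ` {..<r} \<subseteq> I \<and>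
           w * det (mat r r (\<lambda>(p, q). A (f p) (h q))) \<noteq> 0"
  using \<open>r \<le> card J\<close>
proof (induction r)
  case 0
  show ?case using w by simp
next
  case (Suc r)
  then obtain f h where h: "inj_on h {..<r}" "h ` {..<r} \<subseteq> J" and f: "f ` {..<r} \<subseteq> I"
    and nz: "w * det (mat r r (\<lambda>(p, q). A (f p) (h q))) \<noteq> 0" by auto
  have "card (h ` {..<r}) < card J"
    using Suc.prems h(1) by (simp add: card_image)
  then have "h ` {..<r} \<noteq> J" by auto
  then obtain j0 where j0: "j0 \<in> J" "j0 \<notin> h ` {..<r}" using h(2) by blast
  define k where "k = h(r := j0)"
  define M where "M i = mat (Suc r) (Suc r) (\<lambda>(p, q). A ((f(r := i)) p) (k q))" for i
  have k: "inj_on k {..<Suc r}" "k ` {..<Suc r} \<subseteq> J"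
    using h j0 by (auto simp: k_def inj_on_def less_Suc_eq)
  \<comment> \<open>Deleting the last row removes all dependence on \<open>i\<close>, so
    \<open>f 0\<close> is only a placeholder.\<close>
  define C where "C q = cofactor (M (f 0)) r q" for q
  have C: "cofactor (M i) r q = C q" for i q
    unfolding C_def cofactor_def
    by (intro arg_cong2[of _ _ _ _ "(*)"] refl arg_cong[of _ _ det] eq_matI)
       (auto simp: M_def mat_delete_def)
  \<comment> \<open>The corner cofactor is the minor from the induction hypothesis, so
    \<open>v j0\<close> below is nonzero.\<close>
  have Cr: "C r = det (mat r r (\<lambda>(p, q). A (f p) (h q)))"
  proof -
    have "mat_delete (M (f 0)) r r = mat r r (\<lambda>(p, q). A (f p) (h q))"
      by (rule eq_matI) (auto simp: M_def mat_delete_def k_def)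
    then show ?thesis by (simp add: C_def cofactor_def flip: mult_2)
  qed
  have "\<exists>i\<in>I. w * det (M i) \<noteq> 0"
  proof (rule ccontr)
    assume "\<not> ?thesis"
    then have zero: "w * det (M i) = 0" if "i \<in> I" for i using that by blast
    \<comment> \<open>If all minors of size \<open>r + 1\<close> bordering the one already found were killed by \<open>w\<close>, then by
      Laplace expansion along the last row the cofactors times \<open>w\<close> would solve the system.\<close>
    define v where "v j = (if j \<in> k ` {..<Suc r} then w * C (the_inv_into {..<Suc r} k j) else 0)" for j
    have vk: "v (k q) = w * C q" if "q < Suc r" for q
      using that k(1) by (simp add: v_def the_inv_into_f_f)
    have "\<forall>j\<in>J. v j = 0"
    proof (rule inj)
      fix i assume i: "i \<in> I"
      have "(\<Sum>j\<in>J. A i j * v j) = (\<Sum>j\<in>k ` {..<Suc r}. A i j * v j)"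
        by (rule sum.mono_neutral_right) (use \<open>finite J\<close> k in \<open>auto simp: v_def\<close>)
      also have "\<dots> = (\<Sum>q<Suc r. A i (k q) * (w * C q))"
        using k(1) by (subst sum.reindex) (auto simp: vk simp del: sum.lessThan_Suc)
      also have "\<dots> = w * (\<Sum>q<Suc r. M i $$ (r, q) * cofactor (M i) r q)"
        unfolding sum_distrib_left C by (intro sum.cong) (auto simp: M_def)
      also have "\<dots> = w * det (M i)"
        by (subst laplace_expansion_row[of "M i" "Suc r" r]) (auto simp: M_def)
      finally show "(\<Sum>j\<in>J. A i j * v j) = 0" using zero[OF i] by simp
    qed
    moreover have "v j0 = w * C r" using vk[of r] by (simp add: k_def)
    ultimately show False using nz j0(1) Cr by auto
  qed
  then obtain i where i: "i \<in> I" "w * det (M i) \<noteq> 0" by blast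
  have "(f(r := i)) ` {..<Suc r} \<subseteq> I"
    using f i(1) by (auto simp: less_Suc_eq)
  then show ?case using k i(2) unfolding M_def by blast
qed

lemma inj_on_rows_of_minor:
  fixes A :: "'i \<Rightarrow> 'j \<Rightarrow> 'r::comm_ring_1"
  assumes "w * det (mat r r (\<lambda>(p, q). A (f p) (h q))) \<noteq> 0"
  shows "inj_on f {..<r}"
proof (rule inj_onI, rule ccontr)
  fix p q assume *: "p \<in> {..<r}" "q \<in> {..<r}" "f p = f q" "p \<noteq> q"
  then have "det (mat r r (\<lambda>(p, q). A (f p) (h q))) = 0"
    by (intro det_identical_rows[of _ r p q]) (auto intro!: eq_vecI)
  then show False using assms by simp
qed

text \<open>With \<open>w = 1\<close> there is a nonzero minor using all columns, and its rows are
  pairwise distinct.\<close>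

lemma card_le_of_injective_system:
  fixes A :: "'i \<Rightarrow> 'j \<Rightarrow> 'r::comm_ring_1"
  assumes "finite I" "finite J"
    and inj: "\<And>v. (\<And>i. i \<in> I \<Longrightarrow> (\<Sum>j\<in>J. A i j * v j) = 0) \<Longrightarrow> \<forall>j\<in>J. v j = 0"
  shows "card J \<le> card I"
proof -
  obtain f h where "f ` {..<card J} \<subseteq> I"
    and "1 * det (mat (card J) (card J) (\<lambda>(p, q). A (f p) (h q))) \<noteq> 0"
    using nonzero_minor_of_injective_system[of J I A 1 "card J", OF assms(2) inj] by auto
  then show ?thesis
    using inj_on_rows_of_minor \<open>finite I\<close> by (metis card_inj_on_le card_lessThan)
qed

text \<open>Cramer's rule: a kernel vector \<open>u\<close> of the transpose satisfies
  \<open>u i0 * det M = 0\<close> for a square matrix, while \<open>M\<close> is chosen for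
  \<open>w = u i0\<close> such that this product is nonzero.\<close>

lemma injective_transposed_system:
  fixes A :: "'i \<Rightarrow> 'j \<Rightarrow> 'r::comm_ring_1"
  assumes "finite I" "finite J" and card: "card I = card J"
    and inj: "\<And>v. (\<And>i. i \<in> I \<Longrightarrow> (\<Sum>j\<in>J. A i j * v j) = 0) \<Longrightarrow> \<forall>j\<in>J. v j = 0"
    and u: "\<And>j. j \<in> J \<Longrightarrow> (\<Sum>i\<in>I. A i j * u i) = 0"
  shows "\<forall>i\<in>I. u i = 0"
proof (rule ccontr)
  assume "\<not> ?thesis"
  then obtain i0 where i0: "i0 \<in> I" "u i0 \<noteq> 0" by blast
  define n where "n = card J"
  obtain f h where h: "h ` {..<n} \<subseteq> J" and f: "f ` {..<n} \<subseteq> I"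
    and nz: "u i0 * det (mat n n (\<lambda>(p, q). A (f p) (h q))) \<noteq> 0"
    using nonzero_minor_of_injective_system[of J I A "u i0" n, OF assms(2) inj i0(2)]
    by (auto simp: n_def)
  define M where "M = mat n n (\<lambda>(p, q). A (f p) (h q))"
  have M: "M \<in> carrier_mat n n" by (simp add: M_def)
  have injf: "inj_on f {..<n}" by (rule inj_on_rows_of_minor[of "u i0" n A f h, OF nz])
  \<comment> \<open>Distinct rows, as many as \<open>I\<close> has elements: \<open>f\<close>
    enumerates \<open>I\<close>, so sums over \<open>I\<close> become sums over rows of
    \<open>M\<close>.\<close>
  have fI: "f ` {..<n} = I"
    using injf f assms(1) card by (intro card_subset_eq) (auto simp: card_image n_def)
  then obtain p0 where p0: "p0 < n" "f p0 = i0" using i0(1) by blast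
  have zero: "(\<Sum>p<n. A (f p) (h q) * u (f p)) = 0" if "q < n" for q
    using u[of "h q"] h that injf by (simp add: sum.reindex flip: fI) blast
  \<comment> \<open>\<open>M * adj_mat M\<close> is \<open>det M\<close> times the identity;
    expanding it and swapping the sums exposes the column relations \<open>zero\<close>.\<close>
  have "u i0 * det M = (\<Sum>p<n. (M * adj_mat M) $$ (p, p0) * u (f p))"
  proof -
    have "(M * adj_mat M) $$ (p, p0) * u (f p) = (if p = p0 then u i0 * det M else 0)" if "p < n" for p
      using that p0 by (simp add: adj_mat(2)[OF M] mult.commute)
    then show ?thesis using p0 by (simp add: sum.delta)
  qed
  also have "\<dots> = (\<Sum>p<n. \<Sum>q<n. A (f p) (h q) * adj_mat M $$ (q, p0) * u (f p))"
    using M adj_mat(1)[OF M] p0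
    by (intro sum.cong refl)
       (auto simp: times_mat_def scalar_prod_def M_def sum_distrib_right atLeast0LessThan)
  also have "\<dots> = (\<Sum>q<n. adj_mat M $$ (q, p0) * (\<Sum>p<n. A (f p) (h q) * u (f p)))"
    by (subst sum.swap) (simp add: sum_distrib_left ac_simps)
  also have "\<dots> = 0" using zero by simp
  finally show False using nz by (simp add: M_def)
qed

text \<open>As exponents are functions, proof methods tend to eta-expand them, whereupon these rules would
  rewrite \<open>\<alpha> + \<beta>\<close> and \<open>0\<close> to lambda abstractions.\<close>

declare plus_fun_apply [simp del] zero_fun_apply [simp del]

section \<open>Polynomials as finite sums of monomials\<close>

lemma mpol_induct [case_names zero add single]:
  fixes P :: "('n, 'r::comm_ring_1) mpol \<Rightarrow> bool"
  assumes "P 0" and "\<And>p q. P p \<Longrightarrow> P q \<Longrightarrow> P (p + q)"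
    and "\<And>\<alpha> c. P (Poly_Mapping.single \<alpha> c)"
  shows "P p"
proof (induction p rule: update_induct)
  case const
  then show ?case using assms(1) by simp
next
  case (update p \<alpha> c)
  have "Poly_Mapping.update \<alpha> c p = p + Poly_Mapping.single \<alpha> c"
    using update(1)
    by (intro poly_mapping_eqI) (auto simp: lookup_update lookup_add lookup_single in_keys_iff when_def)
  then show ?case using assms update by simp
qed

lemma mpol_eq_sum_singles:
  fixes p :: "('n, 'r::comm_ring_1) mpol"
  shows "p = (\<Sum>\<alpha>\<in>Poly_Mapping.keys p. Poly_Mapping.single \<alpha> (Poly_Mapping.lookup p \<alpha>))"
  by (intro poly_mapping_eqI) (auto simp: lookup_sum lookup_single when_def in_keys_iff)

lemma lookup_single_times_add:
  fixes p :: "('n, 'r::comm_ring_1) mpol"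
  shows "Poly_Mapping.lookup (Poly_Mapping.single \<delta> c * p) (\<delta> + \<gamma>) = c * Poly_Mapping.lookup p \<gamma>"
proof (induction p rule: mpol_induct)
  case (single \<alpha> d)
  have "\<delta> + \<alpha> = \<delta> + \<gamma> \<longleftrightarrow> \<alpha> = \<gamma>" by simp
  then show ?case by (simp add: mult_single lookup_single when_def)
qed (simp_all add: lookup_add algebra_simps)

lemma lookup_single_times_eq_0:
  fixes p :: "('n, 'r::comm_ring_1) mpol"
  assumes "\<not> \<delta> \<le> \<gamma>"
  shows "Poly_Mapping.lookup (Poly_Mapping.single \<delta> c * p) \<gamma> = 0"
proof (induction p rule: mpol_induct)
  case (single \<alpha> d)
  have "\<delta> + \<alpha> \<noteq> \<gamma>" using assms by (auto simp: le_fun_def plus_fun_apply zero_fun_apply)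
  then show ?case by (simp add: mult_single lookup_single when_def)
qed (simp_all add: lookup_add algebra_simps)

text \<open>A sum of exponents vanishes only if both do. Applied to \<open>shift f a\<close>, whose
  constant term is the value of \<open>f\<close> at \<open>a\<close>, this makes evaluation
  multiplicative.\<close>

lemma lookup_times_0:
  fixes p q :: "('n, 'r::comm_ring_1) mpol"
  shows "Poly_Mapping.lookup (p * q) 0 = Poly_Mapping.lookup p 0 * Poly_Mapping.lookup q 0"
proof (induction p rule: mpol_induct)
  case (single \<alpha> c)
  show ?case
  proof (cases "\<alpha> = 0")
    case True
    then show ?thesis using lookup_single_times_add[of 0 c q 0] by simp
  next
    case False
    then have "\<not> \<alpha> \<le> 0" by (auto simp: le_fun_def plus_fun_apply zero_fun_apply fun_eq_iff)
    then show ?thesis using False by (simp add: lookup_single_times_eq_0 lookup_single when_def)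
  qed
qed (simp_all add: lookup_add algebra_simps)

lemma lookup_prod_0:
  fixes p :: "'i \<Rightarrow> ('n, 'r::comm_ring_1) mpol"
  shows "Poly_Mapping.lookup (\<Prod>i\<in>I. p i) 0 = (\<Prod>i\<in>I. Poly_Mapping.lookup (p i) 0)"
  by (induction I rule: infinite_finite_induct) (auto simp: lookup_times_0 lookup_one)

lemma lookup_power_0:
  fixes p :: "('n, 'r::comm_ring_1) mpol"
  shows "Poly_Mapping.lookup (p ^ m) 0 = Poly_Mapping.lookup p 0 ^ m"
  by (induction m) (auto simp: lookup_times_0 lookup_one)

lemma mConst_0: "mConst 0 = 0"
  and mConst_1: "mConst 1 = 1"
  and mConst_add: "mConst (c + d) = mConst c + mConst d"
  and mConst_mult: "mConst (c * d) = mConst c * mConst d"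
  by (simp_all add: mConst_def single_add mult_single)

lemma lookup_mConst_times [simp]:
  "Poly_Mapping.lookup (mConst c * p) \<gamma> = c * Poly_Mapping.lookup p \<gamma>"
  unfolding mConst_def using lookup_single_times_add[of 0 c p \<gamma>] by simp

lemma lookup_mConst_0 [simp]: "Poly_Mapping.lookup (mConst c) 0 = c"
  by (simp add: mConst_def)

lemma mVar_power:
  "mVar i ^ m = Poly_Mapping.single (\<lambda>j. if j = i then m else 0) 1"
  by (induction m)
     (auto simp: mVar_def mult_single zero_fun_def plus_fun_def simp flip: single_one
       intro!: arg_cong[of _ _ "\<lambda>\<alpha>. Poly_Mapping.single \<alpha> 1"])

lemma prod_mVar_power:
  fixes \<alpha> :: "'n::finite \<Rightarrow> nat"
  shows "(\<Prod>i\<in>UNIV. mVar i ^ \<alpha> i) = Poly_Mapping.single \<alpha> 1"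
proof -
  have "(\<Prod>i\<in>I. mVar i ^ \<alpha> i) = Poly_Mapping.single (\<lambda>j. if j \<in> I then \<alpha> j else 0) 1"
    if "finite I" for I
    using that
    by (induction I)
       (auto simp: mVar_power mult_single zero_fun_def plus_fun_def simp flip: single_one
         intro!: arg_cong[of _ _ "\<lambda>\<alpha>. Poly_Mapping.single \<alpha> 1"])
  from this[of UNIV] show ?thesis by simp
qed

lemma lookup_mVar_0 [simp]: "Poly_Mapping.lookup (mVar i) 0 = 0"
  by (auto simp: mVar_def lookup_single when_def fun_eq_iff zero_fun_apply)

section \<open>Substitution and Taylor expansion\<close>

text \<open>Lets several polynomials be expanded over one common set of exponents.\<close>

lemma mSubst_superset:
  assumes "finite K" "Poly_Mapping.keys f \<subseteq> K"
  shows "mSubst f p = (\<Sum>\<alpha>\<in>K. mConst (Poly_Mapping.lookup f \<alpha>) * (\<Prod>i\<in>UNIV. p i ^ \<alpha> i))"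
  unfolding mSubst_def
  by (rule sum.mono_neutral_left) (use assms in \<open>auto simp: in_keys_iff mConst_0\<close>)

lemma mSubst_0: "mSubst 0 p = 0"
  by (simp add: mSubst_def)

lemma mSubst_add: "mSubst (f + g) p = mSubst f p + mSubst g p"
proof -
  let ?K = "Poly_Mapping.keys f \<union> Poly_Mapping.keys g"
  have "Poly_Mapping.keys (f + g) \<subseteq> ?K" by (rule keys_add)
  then show ?thesis
    by (simp add: mSubst_superset[of ?K] lookup_add mConst_add distrib_right sum.distrib)
qed

lemma mSubst_single:
  "mSubst (Poly_Mapping.single \<alpha> c) p = mConst c * (\<Prod>i\<in>UNIV. p i ^ \<alpha> i)"
  by (simp add: mSubst_def mConst_0)

lemma mSubst_mult: "mSubst (f * g) p = mSubst f p * mSubst g p"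
proof (induction f rule: mpol_induct)
  case (single \<alpha> c)
  show ?case
    by (induction g rule: mpol_induct)
       (simp_all add: mSubst_0 mSubst_add mSubst_single mult_single mConst_mult power_add
         plus_fun_apply prod.distrib algebra_simps)
qed (simp_all add: mSubst_0 mSubst_add distrib_right)

lemma shift_0 [simp]: "shift 0 a = 0"
  and shift_add: "shift (f + g) a = shift f a + shift g a"
  and shift_mult: "shift (f * g) a = shift f a * shift g a"
  by (simp_all add: shift_def mSubst_0 mSubst_add mSubst_mult)

lemma shift_mConst [simp]: "shift (mConst c) a = mConst c"
  by (simp add: shift_def mConst_def mSubst_single zero_fun_apply)

lemma shift_1 [simp]: "shift 1 a = 1"
  using shift_mConst[of 1 a] by (simp add: mConst_1)

lemma shift_mVar [simp]: "shift (mVar i) a = mVar i + mConst (a i)"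
proof -
  have "(\<Prod>j\<in>UNIV. (mVar j + mConst (a j)) ^ (if j = i then 1 else 0)) = mVar i + mConst (a i)"
    by (subst prod.mono_neutral_right[of UNIV "{i}"]) auto
  then show ?thesis
    by (simp add: shift_def mVar_def[of i] mSubst_single mConst_1)
qed

lemma shift_minus: "shift (- f) a = - shift f a"
  using shift_add[of f "- f" a] by (simp add: eq_neg_iff_add_eq_0 add.commute)

lemma shift_diff: "shift (f - g) a = shift f a - shift g a"
  using shift_add[of f "- g" a] by (simp add: shift_minus)

lemma shift_power: "shift (f ^ m) a = shift f a ^ m"
  by (induction m) (auto simp: shift_mult)

lemma shift_prod: "shift (\<Prod>i\<in>I. p i) a = (\<Prod>i\<in>I. shift (p i) a)"
  by (induction I rule: infinite_finite_induct) (auto simp: shift_mult)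

lemma lookup_shift_single_0:
  "Poly_Mapping.lookup (shift (Poly_Mapping.single \<alpha> c) a) 0 = c * (\<Prod>i\<in>UNIV. a i ^ \<alpha> i)"
  by (simp add: shift_def mSubst_single lookup_prod_0 lookup_power_0 lookup_add)

section \<open>Ideals and division with remainder\<close>

text \<open>\<open>is_ideal\<close> is phrased through modules, so the facts on submodules are
  instantiated here.\<close>

lemma module_times: "Modules.module ((*) :: 'a::comm_ring_1 \<Rightarrow> 'a \<Rightarrow> 'a)"
  by unfold_locales (simp_all add: algebra_simps)

lemmas is_ideal_def = Modules.module.subspace_def[OF module_times]
  and ideal_add = Modules.module.subspace_add[OF module_times]
  and ideal_scale = Modules.module.subspace_scale[OF module_times]
  and ideal_0 = Modules.module.subspace_0[OF module_times]

text \<open>Holds because \<open>nabla X\<close> is closed upwards; this is what makes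
  \<open>Q_ideal\<close> absorb products.\<close>

lemma keys_mult_subset_nabla:
  assumes "Poly_Mapping.keys p \<subseteq> nabla X"
  shows "Poly_Mapping.keys (f * p) \<subseteq> nabla X"
proof
  fix \<alpha> assume "\<alpha> \<in> Poly_Mapping.keys (f * p)"
  then obtain \<delta> \<beta> where \<alpha>: "\<alpha> = \<delta> + \<beta>" and "\<beta> \<in> Poly_Mapping.keys p"
    using keys_mult by blast
  then obtain \<gamma> where "\<gamma> \<in> X" "\<gamma> \<le> \<beta>" using assms by (auto simp: nabla_def)
  moreover have "\<beta> \<le> \<alpha>" by (simp add: \<alpha> le_fun_def plus_fun_apply)
  ultimately show "\<alpha> \<in> nabla X" by (auto simp: nabla_def intro: order_trans)
qed

lemma is_ideal_Q_ideal: "is_ideal (Q_ideal S B)"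
  unfolding is_ideal_def
proof (intro conjI ballI allI)
  fix f g assume "f \<in> Q_ideal S B" "g \<in> Q_ideal S B"
  then show "f + g \<in> Q_ideal S B"
    unfolding Q_ideal_def by (auto simp: shift_add dest!: keys_add[THEN subsetD])
next
  fix h f assume "f \<in> Q_ideal S B"
  then show "h * f \<in> Q_ideal S B"
    by (simp add: Q_ideal_def shift_mult keys_mult_subset_nabla)
qed (simp add: Q_ideal_def)

section \<open>Monic polynomials and division by them\<close>

lemma
  assumes "monic g"
  shows lookup_lead_exp: "Poly_Mapping.lookup g (lead_exp g) = 1"
    and keys_le_lead_exp: "\<alpha> \<in> Poly_Mapping.keys g \<Longrightarrow> \<alpha> \<le> lead_exp g"
proof -
  obtain \<theta> where \<theta>: "\<theta> \<in> Poly_Mapping.keys g" "\<forall>\<alpha>\<in>Poly_Mapping.keys g. \<alpha> \<le> \<theta>"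
    "Poly_Mapping.lookup g \<theta> = 1"
    using assms by (auto simp: monic_def)
  have "lead_exp g = \<theta>"
    unfolding lead_exp_def by (rule Greatest_equality) (use \<theta> in auto)
  then show "Poly_Mapping.lookup g (lead_exp g) = 1"
    and "\<alpha> \<in> Poly_Mapping.keys g \<Longrightarrow> \<alpha> \<le> lead_exp g"
    using \<theta> by auto
qed

text \<open>Total degree serves as the measure for division and for the choice of a maximal
  exponent.\<close>

lemma sum_exponents_strict_mono:
  fixes \<alpha> \<beta> :: "'n::finite \<Rightarrow> nat"
  assumes "\<alpha> \<le> \<beta>" "\<alpha> \<noteq> \<beta>"
  shows "sum \<alpha> UNIV < sum \<beta> UNIV"
proof (rule sum_strict_mono_ex1)
  show "\<exists>i\<in>UNIV. \<alpha> i < \<beta> i"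
    using assms by (auto simp: le_fun_def fun_eq_iff order_less_le)
qed (use assms in \<open>auto simp: le_fun_def\<close>)

text \<open>All exponents of a monic polynomial lie componentwise below the leading one, so
  rewriting a monomial divisible by a leading monomial leaves terms of smaller total degree. Having
  a remainder is a linear property, so monomials suffice.\<close>

lemma monic_division:
  fixes f :: "('n::finite, 'r::comm_ring_1) mpol"
  assumes Q: "is_ideal Q" and g: "\<And>l. l \<in> \<Lambda> \<Longrightarrow> monic (g l) \<and> g l \<in> Q"
  shows "\<exists>r. f - r \<in> Q \<and> Poly_Mapping.keys r \<inter> nabla ((\<lambda>l. lead_exp (g l)) ` \<Lambda>) = {}"
proof -
  define N where "N = nabla ((\<lambda>l. lead_exp (g l)) ` \<Lambda>)"
  define P where "P p \<longleftrightarrow> (\<exists>r. p - r \<in> Q \<and> Poly_Mapping.keys r \<inter> N = {})" for p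
  have P0: "P 0" unfolding P_def using ideal_0[OF Q] by (intro exI[of _ 0]) simp
  have P_add: "P (p + q)" if "P p" "P q" for p q
  proof -
    obtain r s where r: "p - r \<in> Q" "Poly_Mapping.keys r \<inter> N = {}"
      and s: "q - s \<in> Q" "Poly_Mapping.keys s \<inter> N = {}"
      using \<open>P p\<close> \<open>P q\<close> unfolding P_def by blast
    have eq: "p + q - (r + s) = (p - r) + (q - s)" by simp
    have "p + q - (r + s) \<in> Q" unfolding eq by (rule ideal_add[OF Q r(1) s(1)])
    then show ?thesis unfolding P_def using keys_add[of r s] r(2) s(2) by blast
  qed
  have P_const: "P (mConst c * p)" if "P p" for c p
  proof -
    obtain r where r: "p - r \<in> Q" "Poly_Mapping.keys r \<inter> N = {}"
      using \<open>P p\<close> unfolding P_def by blast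
    have "Poly_Mapping.keys (mConst c * r) \<subseteq> Poly_Mapping.keys r"
      by (auto simp: in_keys_iff)
    moreover have "mConst c * p - mConst c * r \<in> Q"
      using ideal_scale[OF Q r(1), of "mConst c"] by (simp add: right_diff_distrib)
    ultimately show ?thesis unfolding P_def using r(2) by blast
  qed
  have P_Q: "P q" if "q \<in> Q" for q
    unfolding P_def using that by (intro exI[of _ 0]) simp
  have single: "Poly_Mapping.single \<alpha> c = mConst c * Poly_Mapping.single \<alpha> 1" for \<alpha> :: "'n \<Rightarrow> nat" and c :: 'r
    by (simp add: mConst_def mult_single)
  have P_sum: "P p" if monom: "\<And>\<alpha>. \<alpha> \<in> Poly_Mapping.keys p \<Longrightarrow> P (Poly_Mapping.single \<alpha> 1)" for p
  proof -
    have "P (\<Sum>\<alpha>\<in>K. Poly_Mapping.single \<alpha> (Poly_Mapping.lookup p \<alpha>))"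
      if "finite K" "K \<subseteq> Poly_Mapping.keys p" for K
      using that
    proof (induction K)
      case (insert \<alpha> K)
      have "P (Poly_Mapping.single \<alpha> (Poly_Mapping.lookup p \<alpha>))"
        unfolding single[of \<alpha> "Poly_Mapping.lookup p \<alpha>"]
        by (rule P_const, rule monom) (use insert.prems in auto)
      moreover have "P (\<Sum>\<alpha>\<in>K. Poly_Mapping.single \<alpha> (Poly_Mapping.lookup p \<alpha>))"
        using insert by auto
      ultimately show ?case unfolding sum.insert[OF insert.hyps] by (rule P_add)
    qed (use P0 in simp)
    from this[of "Poly_Mapping.keys p"] show ?thesis
      by (simp flip: mpol_eq_sum_singles)
  qed
  have P_monom: "P (Poly_Mapping.single \<alpha> 1)" for \<alpha>
  proof (induction "sum \<alpha> UNIV" arbitrary: \<alpha> rule: less_induct)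
    case less
    show ?case
    proof (cases "\<alpha> \<in> N")
      case False
      then show ?thesis
        unfolding P_def using ideal_0[OF Q] by (intro exI[of _ "Poly_Mapping.single \<alpha> 1"]) auto
    next
      case True
      then obtain l where l: "l \<in> \<Lambda>" "lead_exp (g l) \<le> \<alpha>" by (auto simp: N_def nabla_def)
      define \<theta> where "\<theta> = lead_exp (g l)"
      \<comment> \<open>Truncated subtraction, exact because \<theta> \<le> \<alpha>.\<close>
      define \<delta> where "\<delta> i = \<alpha> i - \<theta> i" for i
      have \<alpha>: "\<alpha> = \<delta> + \<theta>"
        using l(2) by (auto simp: \<theta>_def \<delta>_def le_fun_def fun_eq_iff plus_fun_apply)
      define t where "t = g l - Poly_Mapping.single \<theta> 1"
      have t: "\<beta> \<le> \<theta> \<and> \<beta> \<noteq> \<theta>" if "\<beta> \<in> Poly_Mapping.keys t" for \<beta>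
        using that keys_le_lead_exp[of "g l" \<beta>] lookup_lead_exp[of "g l"] g[OF l(1)]
        by (auto simp: t_def \<theta>_def in_keys_iff lookup_minus lookup_single when_def split: if_splits)
      have 1: "P (- (Poly_Mapping.single \<delta> 1 * t))"
      proof (rule P_sum)
        fix \<gamma> assume "\<gamma> \<in> Poly_Mapping.keys (- (Poly_Mapping.single \<delta> 1 * t))"
        then have "\<gamma> \<in> Poly_Mapping.keys (Poly_Mapping.single \<delta> 1 * t)" by (simp add: in_keys_iff)
        then obtain \<beta> where "\<gamma> = \<delta> + \<beta>" "\<beta> \<in> Poly_Mapping.keys t"
          using keys_mult[of "Poly_Mapping.single \<delta> 1" t] by (auto split: if_splits)
        then have "sum \<gamma> UNIV < sum \<alpha> UNIV"
          using t sum_exponents_strict_mono[of \<beta> \<theta>] by (simp add: \<alpha> plus_fun_apply sum.distrib)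
        then show "P (Poly_Mapping.single \<gamma> 1)" by (rule less)
      qed
      have 2: "P (Poly_Mapping.single \<delta> 1 * g l)"
        by (intro P_Q ideal_scale[OF Q]) (simp add: g[OF l(1)])
      have 3: "Poly_Mapping.single \<alpha> 1 =
          - (Poly_Mapping.single \<delta> 1 * t) + Poly_Mapping.single \<delta> 1 * g l"
        by (simp add: t_def right_diff_distrib mult_single \<alpha>)
      show ?thesis unfolding 3 by (rule P_add[OF 1 2])
    qed
  qed
  have "P f" by (rule P_sum) (rule P_monom)
  then show ?thesis unfolding P_def N_def .
qed

text \<open>Restates the property as a trivial kernel: no nonzero element of \<open>Q\<close> is
  supported where remainders live.\<close>

lemma groebner_basis_iff:
  assumes "is_ideal Q" "finite \<Lambda>" "\<And>l. l \<in> \<Lambda> \<Longrightarrow> monic (g l) \<and> g l \<in> Q"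
  shows "groebner_basis Q \<Lambda> g \<longleftrightarrow>
    (\<forall>\<tau>\<in>Q. Poly_Mapping.keys \<tau> \<inter> nabla ((\<lambda>l. lead_exp (g l)) ` \<Lambda>) = {} \<longrightarrow> \<tau> = 0)"
proof -
  let ?N = "nabla ((\<lambda>l. lead_exp (g l)) ` \<Lambda>)"
  have *: "(\<exists>\<alpha>\<in>Poly_Mapping.keys \<tau>. \<exists>r\<in>\<Lambda>. lead_exp (g r) \<le> \<alpha>) \<longleftrightarrow>
    Poly_Mapping.keys \<tau> \<inter> ?N \<noteq> {}" for \<tau>
    by (auto simp: nabla_def)
  have "groebner_basis Q \<Lambda> g \<longleftrightarrow> (\<forall>\<tau>\<in>Q - {0}. Poly_Mapping.keys \<tau> \<inter> ?N \<noteq> {})"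
    unfolding groebner_basis_def * using assms by simp
  then show ?thesis by auto
qed

section \<open>Independence of the Taylor coefficient functionals\<close>

text \<open>Matrix form of a Taylor functional: its entries are the values on monomials.\<close>

lemma lookup_shift_eq_sum:
  assumes "finite J" "Poly_Mapping.keys f \<subseteq> J"
  shows "Poly_Mapping.lookup (shift f a) \<gamma> =
    (\<Sum>\<alpha>\<in>J. Poly_Mapping.lookup (shift (Poly_Mapping.single \<alpha> 1) a) \<gamma> * Poly_Mapping.lookup f \<alpha>)"
  using assms
  by (simp add: shift_def mSubst_superset[OF assms] lookup_sum mSubst_single mConst_1 mult.commute)

text \<open>Since \<open>w\<close> kills each \<open>a i - a' i\<close>, in a product with
  \<open>w\<close> the factors \<open>a i\<close> may be exchanged for \<open>a' i\<close> one at a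
  time; hence \<open>w\<close> cannot distinguish the values of \<open>f\<close> at the two
  points.\<close>

lemma lookup_shift_0_cong:
  fixes f :: "('n::finite, 'r::comm_ring_1) mpol"
  assumes "\<And>i. w * a i = w * a' i"
  shows "w * Poly_Mapping.lookup (shift f a) 0 = w * Poly_Mapping.lookup (shift f a') 0"
proof (induction f rule: mpol_induct)
  case (single \<alpha> c)
  have power: "w * a i ^ m = w * a' i ^ m" for i m
  proof (induction m)
    case (Suc m)
    have "w * a i ^ Suc m = a i * (w * a i ^ m)" by (simp add: mult.left_commute)
    also have "\<dots> = (w * a i) * a' i ^ m" unfolding Suc by (simp add: mult_ac)
    finally show ?case by (simp add: assms mult_ac)
  qed simp
  have "w * (\<Prod>i\<in>K. a i ^ \<alpha> i) = w * (\<Prod>i\<in>K. a' i ^ \<alpha> i)" if "finite K" for K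
    using that
  proof (induction K)
    case (insert i K)
    have "w * (\<Prod>i\<in>insert i K. a i ^ \<alpha> i) = a i ^ \<alpha> i * (w * (\<Prod>i\<in>K. a i ^ \<alpha> i))"
      using insert.hyps by (simp add: mult.left_commute)
    also have "\<dots> = (w * a i ^ \<alpha> i) * (\<Prod>i\<in>K. a' i ^ \<alpha> i)"
      unfolding insert.IH by (simp add: mult_ac)
    finally show ?case using insert.hyps by (simp add: power mult_ac)
  qed simp
  from this[of UNIV] show ?case by (simp add: lookup_shift_single_0 mult.left_commute)
qed (simp_all add: shift_add lookup_add distrib_left)

section \<open>Products of elements that are not zero divisors\<close>

lemma not_zero_divisor_mult:
  "\<not> zero_divisor c \<Longrightarrow> \<not> zero_divisor d \<Longrightarrow> \<not> zero_divisor (c * d)"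
  unfolding zero_divisor_def by (metis mult.assoc)

lemma not_zero_divisor_1: "\<not> zero_divisor 1"
  by (simp add: zero_divisor_def)

lemma not_zero_divisor_power: "\<not> zero_divisor c \<Longrightarrow> \<not> zero_divisor (c ^ m)"
  by (induction m) (simp_all add: not_zero_divisor_1 not_zero_divisor_mult)

lemma not_zero_divisor_prod:
  "(\<And>i. i \<in> K \<Longrightarrow> \<not> zero_divisor (c i)) \<Longrightarrow> \<not> zero_divisor (\<Prod>i\<in>K. c i)"
  by (induction K rule: infinite_finite_induct)
     (simp_all add: not_zero_divisor_1 not_zero_divisor_mult)

text \<open>A nontrivial relation is tested on one polynomial \<open>f\<close> that isolates a
  single nonzero \<open>u (a, \<beta>)\<close>, multiplied by a product of differences in the
  \<open>S i\<close>; Condition (D) keeps that product from being a zero divisor.\<close>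

lemma taylor_coefficients_independent:
  fixes S :: "'n::finite \<Rightarrow> 'r::comm_ring_1 set"
  assumes "\<And>i. finite (S i)" and D: "\<And>i. condition_D (S i)"
    and "finite I" and I: "I \<subseteq> Pi UNIV S \<times> UNIV"
    and zero: "\<And>f. (\<Sum>(a, \<gamma>)\<in>I. Poly_Mapping.lookup (shift f a) \<gamma> * u (a, \<gamma>)) = 0"
  shows "\<forall>i\<in>I. u i = 0"
proof (rule ccontr)
  define K where "K = {i\<in>I. u i \<noteq> 0}"
  define d :: "('n \<Rightarrow> 'r) \<times> ('n \<Rightarrow> nat) \<Rightarrow> nat" where "d i = sum (snd i) UNIV" for i
  assume "\<not> ?thesis"
  then have "K \<noteq> {}" "finite K" using \<open>finite I\<close> by (auto simp: K_def)
  then have "Max (d ` K) \<in> d ` K" by simp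
  then obtain i where i: "i \<in> K" "Max (d ` K) = d i" by blast
  obtain a \<beta> where [simp]: "i = (a, \<beta>)" by fastforce
  have K: "(a, \<beta>) \<in> K" using i(1) by simp
  have max: "d j \<le> d (a, \<beta>)" if "j \<in> K" for j
    using Max_ge[of "d ` K" "d j"] that i(2) \<open>finite K\<close> by simp
  have a: "(a, \<beta>) \<in> I" "u (a, \<beta>) \<noteq> 0" "\<And>i. a i \<in> S i"
    using K I by (auto simp: K_def)
  \<comment> \<open>Larger than every component of every exponent in \<open>I\<close>, so a multiple
    of \<open>mVar j ^ N\<close> has no coefficient there.\<close>
  define N where "N = Suc (sum d I)"
  have N: "\<gamma> j < N" if "(a', \<gamma>) \<in> I" for a' \<gamma> j
  proof -
    have "\<gamma> j \<le> sum \<gamma> UNIV" by (rule member_le_sum) auto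
    also have "\<dots> \<le> sum d I"
      using member_le_sum[OF that, of d] \<open>finite I\<close> by (simp add: d_def)
    finally show ?thesis by (simp add: N_def)
  qed
  \<comment> \<open>The second factor of \<open>f\<close> annihilates the terms at all points other than \<open>a\<close>; at \<open>a\<close> the first
    one leaves only \<open>\<beta>\<close>, since it was chosen of maximal degree.\<close>
  define f where "f = (\<Prod>i\<in>UNIV. (mVar i - mConst (a i)) ^ \<beta> i) *
    (\<Prod>i\<in>UNIV. \<Prod>b\<in>S i - {a i}. (mVar i - mConst b) ^ N)"
  \<comment> \<open>The second factor of \<open>f\<close> expanded at \<open>a\<close>; its constant
    term is the product of the \<open>(a i - b) ^ N\<close>.\<close>
  define P where "P = (\<Prod>i\<in>UNIV. \<Prod>b\<in>S i - {a i}. (mVar i + mConst (a i) - mConst b) ^ N)"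
  have shift_a: "shift f a = Poly_Mapping.single \<beta> 1 * P"
    by (simp add: f_def P_def shift_mult shift_prod shift_power shift_diff prod_mVar_power)
  have other: "Poly_Mapping.lookup (shift f a') \<gamma> = 0" if "(a', \<gamma>) \<in> I" "a' \<noteq> a" for a' \<gamma>
  proof -
    obtain j where j: "a' j \<noteq> a j" using \<open>a' \<noteq> a\<close> by (auto simp: fun_eq_iff)
    have "a' j \<in> S j - {a j}" using that(1) I j by auto
    \<comment> \<open>The factor for \<open>b = a' j\<close> turns into \<open>mVar j ^ N\<close>
      after the shift by \<open>a'\<close>.\<close>
    then have "(mVar j + mConst (a' j) - mConst (a' j)) ^ N dvd
        (\<Prod>b\<in>S j - {a j}. (mVar j + mConst (a' j) - mConst b) ^ N)"
      by (intro dvd_prodI) (use assms(1) in auto)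
    also have "\<dots> dvd (\<Prod>i\<in>UNIV. \<Prod>b\<in>S i - {a i}. (mVar i + mConst (a' i) - mConst b) ^ N)"
      by (rule dvd_prodI) auto
    also have "\<dots> dvd shift f a'"
      by (simp add: f_def shift_mult shift_prod shift_power shift_diff)
    finally obtain q where q: "shift f a' = mVar j ^ N * q" by (auto elim: dvdE)
    have "\<not> (\<lambda>i. if i = j then N else 0) \<le> \<gamma>"
      using N[OF that(1), of j] by (auto simp: le_fun_def not_le)
    then show ?thesis unfolding q mVar_power by (rule lookup_single_times_eq_0)
  qed
  have "(case i of (a', \<gamma>) \<Rightarrow> Poly_Mapping.lookup (shift f a') \<gamma> * u (a', \<gamma>)) =
      (if i = (a, \<beta>) then Poly_Mapping.lookup P 0 * u (a, \<beta>) else 0)" if "i \<in> I" for i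
  proof -
    obtain a' \<gamma> where i: "i = (a', \<gamma>)" by fastforce
    consider "a' \<noteq> a" | "u i = 0" "i \<noteq> (a, \<beta>)" | "a' = a" "u i \<noteq> 0" "\<gamma> \<noteq> \<beta>" | "i = (a, \<beta>)"
      using i a(2) by blast
    then show ?thesis
    proof cases
      case 1
      then show ?thesis using other that i by auto
    next
      case 3
      then have "d i \<le> d (a, \<beta>)" using max that by (auto simp: K_def)
      \<comment> \<open>Otherwise \<gamma> would have larger degree than the maximal
        \<beta>.\<close>
      then have "\<not> \<beta> \<le> \<gamma>" using sum_exponents_strict_mono[of \<beta> \<gamma>] 3(3) i by (auto simp: d_def)
      then show ?thesis using 3 i by (simp add: shift_a lookup_single_times_eq_0)
    next
      case 4
      then show ?thesis using lookup_single_times_add[of \<beta> 1 P 0] by (simp add: shift_a)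
    qed (use i in auto)
  qed
  then have "(\<Sum>(a', \<gamma>)\<in>I. Poly_Mapping.lookup (shift f a') \<gamma> * u (a', \<gamma>)) =
      Poly_Mapping.lookup P 0 * u (a, \<beta>)"
    using a(1) \<open>finite I\<close> by (simp add: sum.delta)
  then have "Poly_Mapping.lookup P 0 * u (a, \<beta>) = 0" using zero by simp
  moreover have "\<not> zero_divisor (Poly_Mapping.lookup P 0)"
  proof -
    have "\<not> zero_divisor (a i - b)" if "b \<in> S i - {a i}" for i b
      using D[of i] that a(3)[of i] by (auto simp: condition_D_def)
    then show ?thesis
      unfolding P_def
      by (auto simp: lookup_prod_0 lookup_power_0 lookup_add lookup_minus
          intro!: not_zero_divisor_prod not_zero_divisor_power)
  qed
  ultimately show False using a(2) by (auto simp: zero_divisor_def)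
qed

section \<open>Groebner bases and counting\<close>

theorem theorem4p1:
  fixes S :: "'n::finite \<Rightarrow> 'r::comm_ring_1 set"
    and B :: "('n \<Rightarrow> 'r) \<Rightarrow> ('n \<Rightarrow> nat) set"
    and \<Lambda> :: "'l set"
    and g :: "'l \<Rightarrow> ('n, 'r) mpol"
    and Q :: "('n, 'r) mpol set"
    and D :: "('n \<Rightarrow> nat) set"
    and \<zeta>1 \<zeta>2 :: nat
  assumes "\<And>i. finite (S i)"
    and "\<And>a. a \<in> Pi UNIV S \<Longrightarrow> finite (UNIV - nabla (B a))"
    and "\<zeta>1 = (\<Sum>a\<in>Pi UNIV S. card (UNIV - nabla (B a)))"
    and "Q = Q_ideal S B"
    and "finite \<Lambda>"
    and "\<And>l. l \<in> \<Lambda> \<Longrightarrow> g l \<in> Q"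
    and "\<And>l. l \<in> \<Lambda> \<Longrightarrow> monic (g l)"
    and "D = (\<lambda>l. lead_exp (g l)) ` \<Lambda>"
    and "finite (UNIV - nabla D)"
    and "\<zeta>2 = card (UNIV - nabla D)"
  shows "is_ideal Q \<and>
     ((\<forall>i. condition_D (S i)) \<longrightarrow>
        \<zeta>1 \<le> \<zeta>2 \<and> (groebner_basis Q \<Lambda> g \<longleftrightarrow> \<zeta>1 = \<zeta>2)) \<and>
     (Pi UNIV S \<noteq> {} \<and> (\<forall>a\<in>Pi UNIV S. 0 \<notin> B a) \<and> \<zeta>1 \<le> \<zeta>2 \<and> groebner_basis Q \<Lambda> g \<longrightarrow>
        \<zeta>1 = \<zeta>2 \<and> (\<forall>k. condition_D (S k)))"
proof -
  define I where "I = Sigma (Pi UNIV S) (\<lambda>a. UNIV - nabla (B a))"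
  define J where "J = UNIV - nabla D"
  define A where "A i \<alpha> = Poly_Mapping.lookup (shift (Poly_Mapping.single \<alpha> 1) (fst i)) (snd i)"
    for i :: "('n \<Rightarrow> 'r) \<times> ('n \<Rightarrow> nat)" and \<alpha>
  define injective where "injective \<longleftrightarrow>
    (\<forall>v. (\<forall>i\<in>I. (\<Sum>\<alpha>\<in>J. A i \<alpha> * v \<alpha>) = 0) \<longrightarrow> (\<forall>\<alpha>\<in>J. v \<alpha> = 0))"
  \<comment> \<open>Extensionality is vacuous over \<open>UNIV\<close>, so finiteness of
    \<open>PiE\<close> applies.\<close>
  have "Pi UNIV S = PiE UNIV S" by (auto simp: PiE_def)
  then have fin_Pi: "finite (Pi UNIV S)" using assms(1) by (simp add: finite_PiE)
  have fin_I: "finite I" unfolding I_def using fin_Pi assms(2) by (rule finite_SigmaI)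
  have fin_J: "finite J" using assms(9) by (simp add: J_def)
  have card_I: "card I = \<zeta>1"
    unfolding I_def assms(3) by (rule card_SigmaI) (use fin_Pi assms(2) in auto)
  have card_J: "card J = \<zeta>2" by (simp add: J_def assms(10))
  have ideal: "is_ideal Q" unfolding assms(4) by (rule is_ideal_Q_ideal)
  have in_Q: "f \<in> Q \<longleftrightarrow> (\<forall>i\<in>I. Poly_Mapping.lookup (shift f (fst i)) (snd i) = 0)" for f
    unfolding assms(4) Q_ideal_def I_def by (auto simp: in_keys_iff subset_iff)
  have A_sum: "Poly_Mapping.lookup (shift f (fst i)) (snd i) =
      (\<Sum>\<alpha>\<in>J. A i \<alpha> * Poly_Mapping.lookup f \<alpha>)" if "Poly_Mapping.keys f \<subseteq> J" for f i
    unfolding A_def by (rule lookup_shift_eq_sum[OF fin_J that])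
  have GB: "groebner_basis Q \<Lambda> g \<longleftrightarrow> injective"
  proof -
    have "groebner_basis Q \<Lambda> g \<longleftrightarrow>
        (\<forall>\<tau>\<in>Q. Poly_Mapping.keys \<tau> \<inter> nabla D = {} \<longrightarrow> \<tau> = 0)"
      unfolding assms(8) by (rule groebner_basis_iff[OF ideal assms(5)]) (use assms in simp)
    also have "\<dots> \<longleftrightarrow> (\<forall>\<tau>\<in>Q. Poly_Mapping.keys \<tau> \<subseteq> J \<longrightarrow> \<tau> = 0)"
      by (simp add: J_def disjoint_eq_subset_Compl Compl_eq_Diff_UNIV)
    also have "\<dots> \<longleftrightarrow> injective"
    proof
      assume *: "\<forall>\<tau>\<in>Q. Poly_Mapping.keys \<tau> \<subseteq> J \<longrightarrow> \<tau> = 0"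
      show injective unfolding injective_def
      proof (intro allI impI)
        fix v assume v: "\<forall>i\<in>I. (\<Sum>\<alpha>\<in>J. A i \<alpha> * v \<alpha>) = 0"
        \<comment> \<open>A kernel vector of \<open>A\<close>, read as coefficients on
          \<open>J\<close>, is an element of \<open>Q\<close>.\<close>
        define \<tau> where "\<tau> = (\<Sum>\<alpha>\<in>J. Poly_Mapping.single \<alpha> (v \<alpha>))"
        have \<tau>: "Poly_Mapping.lookup \<tau> \<alpha> = (if \<alpha> \<in> J then v \<alpha> else 0)" for \<alpha>
          using fin_J by (simp add: \<tau>_def lookup_sum lookup_single when_def)
        have "Poly_Mapping.keys \<tau> \<subseteq> J" by (auto simp: in_keys_iff \<tau> split: if_splits)
        then have "\<tau> = 0" using * v by (simp add: in_Q A_sum \<tau>)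
        then show "\<forall>\<alpha>\<in>J. v \<alpha> = 0" using \<tau> by (metis lookup_zero)
      qed
    next
      assume *: injective
      show "\<forall>\<tau>\<in>Q. Poly_Mapping.keys \<tau> \<subseteq> J \<longrightarrow> \<tau> = 0"
      proof (intro ballI impI)
        fix \<tau> assume \<tau>: "\<tau> \<in> Q" "Poly_Mapping.keys \<tau> \<subseteq> J"
        then have "\<forall>\<alpha>\<in>J. Poly_Mapping.lookup \<tau> \<alpha> = 0"
          using *[unfolded injective_def, rule_format, of "Poly_Mapping.lookup \<tau>"]
          by (simp add: in_Q A_sum)
        then show "\<tau> = 0"
          using \<tau>(2) by (intro poly_mapping_eqI) (auto simp: in_keys_iff subset_iff)
      qed
    qed
    finally show ?thesis .
  qed
  have inj_rule: "\<forall>\<alpha>\<in>J. v \<alpha> = 0" if injective "\<And>i. i \<in> I \<Longrightarrow> (\<Sum>\<alpha>\<in>J. A i \<alpha> * v \<alpha>) = 0" for v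
    using that unfolding injective_def by blast
  have injective_le: "\<zeta>2 \<le> \<zeta>1" if injective
    using card_le_of_injective_system[of I J A, OF fin_I fin_J inj_rule[OF that]]
    by (simp add: card_I card_J)
  have part1: "\<zeta>1 \<le> \<zeta>2 \<and> (groebner_basis Q \<Lambda> g \<longleftrightarrow> \<zeta>1 = \<zeta>2)" if D: "\<forall>i. condition_D (S i)"
  proof -
    have rows: "\<forall>i\<in>I. u i = 0" if u: "\<And>\<alpha>. \<alpha> \<in> J \<Longrightarrow> (\<Sum>i\<in>I. A i \<alpha> * u i) = 0" for u
    proof (rule taylor_coefficients_independent[of S])
      show "(\<Sum>(a, \<gamma>)\<in>I. Poly_Mapping.lookup (shift f a) \<gamma> * u (a, \<gamma>)) = 0" for f
      proof -
        \<comment> \<open>The functionals in \<open>I\<close> vanish on \<open>f - r\<close>, so the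
          relation \<open>u\<close>, known on monomials in \<open>J\<close>, passes from
          \<open>r\<close> to \<open>f\<close>.\<close>
        obtain r where r: "f - r \<in> Q" "Poly_Mapping.keys r \<inter> nabla D = {}"
          using monic_division[OF ideal, of \<Lambda> g f] assms(6-8) by auto
        have keys_r: "Poly_Mapping.keys r \<subseteq> J" using r(2) by (auto simp: J_def)
        have "(\<Sum>i\<in>I. Poly_Mapping.lookup (shift f (fst i)) (snd i) * u i) =
            (\<Sum>i\<in>I. (\<Sum>\<alpha>\<in>J. A i \<alpha> * Poly_Mapping.lookup r \<alpha>) * u i)"
          using r(1) by (intro sum.cong refl) (simp add: in_Q shift_diff lookup_minus A_sum[OF keys_r])
        also have "\<dots> = (\<Sum>\<alpha>\<in>J. Poly_Mapping.lookup r \<alpha> * (\<Sum>i\<in>I. A i \<alpha> * u i))"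
          unfolding sum_distrib_right sum_distrib_left by (subst sum.swap) (simp add: mult_ac)
        also have "\<dots> = 0" using u by simp
        finally show ?thesis by (simp add: case_prod_unfold)
      qed
    qed (use assms(1) D fin_I in \<open>auto simp: I_def\<close>)
    \<comment> \<open>The transposed matrix is injective by \<open>rows\<close>, so the roles of
      \<open>I\<close> and \<open>J\<close> are exchanged here and in the next step.\<close>
    have le: "\<zeta>1 \<le> \<zeta>2"
      using card_le_of_injective_system[of J I "\<lambda>\<alpha> i. A i \<alpha>", OF fin_J fin_I rows]
      by (simp add: card_I card_J)
    have injective if eq: "\<zeta>1 = \<zeta>2"
      unfolding injective_def
    proof (intro allI impI)
      fix v assume v: "\<forall>i\<in>I. (\<Sum>\<alpha>\<in>J. A i \<alpha> * v \<alpha>) = 0"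
      show "\<forall>\<alpha>\<in>J. v \<alpha> = 0"
        by (rule injective_transposed_system[of J I "\<lambda>\<alpha> i. A i \<alpha>", OF fin_J fin_I _ rows])
          (use v eq card_I card_J in auto)
    qed
    then show ?thesis using le injective_le GB by auto
  qed
  have part2: "\<zeta>1 = \<zeta>2 \<and> (\<forall>k. condition_D (S k))"
    if ne: "Pi UNIV S \<noteq> {}" and B0: "\<forall>a\<in>Pi UNIV S. 0 \<notin> B a" and le: "\<zeta>1 \<le> \<zeta>2"
      and gb: "groebner_basis Q \<Lambda> g"
  proof
    have inj: injective using gb GB by simp
    show eq: "\<zeta>1 = \<zeta>2" using le injective_le[OF inj] by simp
    \<comment> \<open>Only 0 lies below 0, so evaluation at each point of the product is among the
      rows.\<close>
    have I0: "(a, 0) \<in> I" if "a \<in> Pi UNIV S" for a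
    proof -
      have "\<beta> = 0" if "\<beta> \<le> 0" for \<beta> :: "'n \<Rightarrow> nat"
        using that by (auto simp: le_fun_def fun_eq_iff zero_fun_apply)
      then show ?thesis using that B0 unfolding I_def nabla_def by blast
    qed
    show "\<forall>k. condition_D (S k)"
    proof (rule ccontr)
      assume "\<not> ?thesis"
      then obtain k b c w where bc: "b \<in> S k" "c \<in> S k" "b \<noteq> c" and w: "w \<noteq> 0" "(c - b) * w = 0"
        unfolding condition_D_def zero_divisor_def by blast
      obtain a0 where a0: "a0 \<in> Pi UNIV S" using ne by blast
      \<comment> \<open>The rows evaluating at two points that differ only in coordinate
        \<open>k\<close>; \<open>w\<close> times their difference vanishes, which gives the kernel
        vector \<open>u\<close> of the transpose.\<close>
      define p q where "p = (a0(k := b), 0 :: 'n \<Rightarrow> nat)" and "q = (a0(k := c), 0 :: 'n \<Rightarrow> nat)"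
      have pq: "p \<in> I" "q \<in> I"
        using a0 bc by (auto simp: p_def q_def Pi_iff intro!: I0)
      have "p \<noteq> q" using bc(3) by (auto simp: p_def q_def dest: fun_cong[of _ _ k])
      define u where "u i = (if i = p then w else if i = q then - w else 0)" for i
      have wbc: "w * b = w * c" using w(2) by (simp add: algebra_simps)
      have A_eq: "w * A p \<alpha> = w * A q \<alpha>" for \<alpha>
        unfolding A_def p_def q_def fst_conv snd_conv
        by (rule lookup_shift_0_cong) (use wbc in simp)
      have "\<forall>i\<in>I. u i = 0"
      proof (rule injective_transposed_system[of I J A, OF fin_I fin_J _ inj_rule[OF inj]])
        show "card I = card J" using card_I card_J eq by simp
        fix \<alpha>
        have "(\<Sum>i\<in>I. A i \<alpha> * u i) = (\<Sum>i\<in>{p, q}. A i \<alpha> * u i)"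
          by (rule sum.mono_neutral_right) (use fin_I pq in \<open>auto simp: u_def\<close>)
        also have "\<dots> = 0" using \<open>p \<noteq> q\<close> A_eq[of \<alpha>] by (simp add: u_def mult.commute)
        finally show "(\<Sum>i\<in>I. A i \<alpha> * u i) = 0" .
      qed
      then have "u p = 0" using pq(1) by blast
      then show False using w(1) by (simp add: u_def)
    qed
  qed
  show ?thesis using ideal part1 part2 by simp
qed

end
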